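(* Let $G$ be a simple connected graph with vertex set $V(G)=\{t_1,\dots,t_n\}$, let $\mathbb{K}$ be a field, and let $\mathcal{N}_G\subseteq S=\mathbb{K}[t_1,\dots,t_n]$ be the closed neighborhood ideal of $G$. Then $$\mathtt{v}(\mathcal{N}_G)\le 2\,a(G),$$ where $a(G)$ is the matching number of $G$.
   Context: Graphs are finite and simple. The vertices of $G$ are identified with the variables $t_1,\dots,t_n$ of $S=\mathbb{K}[t_1,\dots,t_n]=\bigoplus_{d\ge 0}S_d$ (standard grading). The matching number $a(G)$ is the maximum cardinality of a set of edges of $G$ no two of which share a vertex. For a vertex $v$, $\mathtt{N}[v]$ is the set consisting of $v$ and all its neighbors. For $A\subseteq V(G)$, $\mathbf{t}_A=\prod_{t_j\in A}t_j$. The closed neighborhood ideal of $G$ is $\mathcal{N}_G=\langle \mathbf{t}_{\mathtt{N}[t_i]} : t_i\in V(G)\rangle\subseteq S$. For a graded ideal $I\subseteq S$, $(I:f)=\{g\in S : gf\in I\}$, $\operatorname{Ass}(I)$ is the set of associated primes of $S/I$, and the $\mathtt{v}$-number of $I$ is $$\mathtt{v}(I)=\min\{d\ge 0 : \exists\, f\in S_d \text{ and } \mathfrak{p}\in\operatorname{Ass}(I)\text{ with }(I:f)=\mathfrak{p}\}.$$ *)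

theory Defs
  imports
    "HOL-Library.Poly_Mapping"
    "HOL-Library.Disjoint_Sets"
    "HOL-Algebra.QuotRing"
    "HOL-Algebra.Algebraic_Closure_Type"
begin

text \<open>A graph is given by its edge set; its vertex set is the whole finite type \<open>'v\<close>.\<close>

definition simple_graph :: "'v::finite set set \<Rightarrow> bool" where
  "simple_graph E \<longleftrightarrow> (\<forall>e\<in>E. card e = 2)"

definition adjacent :: "'v set set \<Rightarrow> 'v \<Rightarrow> 'v \<Rightarrow> bool" where
  "adjacent E u v \<longleftrightarrow> {u, v} \<in> E"

definition connected_graph :: "'v set set \<Rightarrow> bool" where
  "connected_graph E \<longleftrightarrow> (\<forall>u v. (adjacent E)\<^sup>*\<^sup>* u v)"

definition matching :: "'v set set \<Rightarrow> 'v set set \<Rightarrow> bool" where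
  "matching E M \<longleftrightarrow> M \<subseteq> E \<and> disjoint M"

definition matching_number :: "'v::finite set set \<Rightarrow> nat" where
  "matching_number E = Max {card M | M. matching E M}"

definition closed_nbhd :: "'v set set \<Rightarrow> 'v \<Rightarrow> 'v set" where
  "closed_nbhd E v = insert v {u. adjacent E v u}"

text \<open>
  A monomial is its exponent vector \<open>'v \<Rightarrow>\<^sub>0 nat\<close>; a polynomial maps monomials to
  coefficients, and the product of type \<^typ>\<open>('v \<Rightarrow>\<^sub>0 nat) \<Rightarrow>\<^sub>0 'k\<close> is convolution.
\<close>

type_synonym ('v, 'k) mpoly = "('v \<Rightarrow>\<^sub>0 nat) \<Rightarrow>\<^sub>0 'k"

abbreviation mpoly_ring :: "('v, 'k::field) mpoly ring" where
  "mpoly_ring \<equiv> ring_of_type_algebra"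

definition var :: "'v \<Rightarrow> ('v, 'k::field) mpoly" where
  "var v = Poly_Mapping.single (Poly_Mapping.single v 1) 1"

definition total_degree :: "('v::finite \<Rightarrow>\<^sub>0 nat) \<Rightarrow> nat" where
  "total_degree m = (\<Sum>v\<in>UNIV. Poly_Mapping.lookup m v)"

text \<open>The graded component \<open>S\<^sub>d\<close>; it contains \<open>0\<close> for every \<open>d\<close>.\<close>

definition graded_component :: "nat \<Rightarrow> ('v::finite, 'k::field) mpoly set" where
  "graded_component d = {f. \<forall>m\<in>Poly_Mapping.keys f. total_degree m = d}"

definition closed_nbhd_ideal :: "'v::finite set set \<Rightarrow> ('v, 'k::field) mpoly set" where
  "closed_nbhd_ideal E =
     genideal mpoly_ring {\<Prod>u\<in>closed_nbhd E v. var u | v. True}"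

definition colon_ideal ::
    "('a, 'b) ring_scheme \<Rightarrow> 'a set \<Rightarrow> 'a \<Rightarrow> 'a set" where
  "colon_ideal R I f = {g \<in> carrier R. g \<otimes>\<^bsub>R\<^esub> f \<in> I}"

text \<open>
  The associated primes of the module \<open>R/I\<close>: the prime ideals of \<open>R\<close> that are annihilators of
  an element of \<open>R/I\<close>, where \<open>g \<in> R\<close> acts on \<open>R/I\<close> as multiplication by its residue class.
\<close>

definition associated_primes :: "('a, 'b) ring_scheme \<Rightarrow> 'a set \<Rightarrow> 'a set set" where
  "associated_primes R I =
     {P. primeideal P R \<and>
         (\<exists>x \<in> carrier (R Quot I).
            P = {g \<in> carrier R. (I +>\<^bsub>R\<^esub> g) \<otimes>\<^bsub>R Quot I\<^esub> x = \<zero>\<^bsub>R Quot I\<^esub>})}"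

definition v_number :: "('v::finite, 'k::field) mpoly set \<Rightarrow> nat" where
  "v_number I =
     (LEAST d. \<exists>f \<in> graded_component d. \<exists>P \<in> associated_primes mpoly_ring I.
        colon_ideal mpoly_ring I f = P)"

end

theory Submission
  imports Defs
begin

text \<open>
  Let \<open>M\<close> be a maximum matching. The vertices missed by \<open>M\<close> form an independent set, since an edge
  between two of them could be added to \<open>M\<close>. Extend this set to a maximal independent set \<open>C\<close>.
  Then the complement \<open>A\<close> of \<open>C\<close> consists of vertices covered by \<open>M\<close>, so it has at most twice as
  many elements as \<open>M\<close>. The witness for the \<open>v\<close>-number is the squarefree monomial
  \<open>f = \<Prod>u\<in>A. t\<^sub>u\<close> of degree \<open>card A\<close>.

  Multiplying by \<open>f\<close> makes all variables outside \<open>C\<close> available. Hence \<open>g * f\<close> lies in the closed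
  neighborhood ideal iff each monomial of \<open>g\<close> is divisible by the part inside \<open>C\<close> of some closed
  neighborhood. Maximality of \<open>C\<close> means that every closed neighborhood meets \<open>C\<close>; independence
  means that the closed neighborhood of \<open>c \<in> C\<close> meets \<open>C\<close> in \<open>c\<close> only. So the colon ideal is
  generated by the variables in \<open>C\<close> (\<open>colon_closed_nbhd_ideal\<close>). Such an ideal is prime
  (\<open>primeideal_variables\<close>), and a prime colon ideal is by definition an associated prime
  (\<open>prime_colon_associated\<close>).

  On the algebraic side everything is reduced to exponent vectors: an ideal generated by monomials
  consists of the polynomials all of whose monomials are divisible by a generator
  (\<open>genideal_monomials\<close>).
\<close>

section \<open>Matchings and maximal independent sets\<close>

definition independent :: "'v set set \<Rightarrow> 'v set \<Rightarrow> bool" where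
  "independent E C \<longleftrightarrow> (\<forall>u\<in>C. \<forall>v\<in>C. {u, v} \<notin> E)"

definition dominating :: "'v set set \<Rightarrow> 'v set \<Rightarrow> bool" where
  "dominating E C \<longleftrightarrow> (\<forall>v. closed_nbhd E v \<inter> C \<noteq> {})"

text \<open>
  A maximal independent set above \<open>U\<close> will do: a vertex whose closed neighborhood avoids it could
  be added. Simplicity enters because \<open>independent\<close> also forbids loops.
\<close>

lemma independent_extends_to_dominating:
  fixes E :: "'v::finite set set"
  assumes "simple_graph E" and "independent E U"
  obtains C where "U \<subseteq> C" "independent E C" "dominating E C"
proof -
  obtain C where C: "independent E C" "U \<subseteq> C"
    and max: "\<And>D. independent E D \<Longrightarrow> C \<subseteq> D \<Longrightarrow> D = C"
    using finite_has_maximal2[of "{C. independent E C}" U] assms(2) by auto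
  have "closed_nbhd E v \<inter> C \<noteq> {}" for v
  proof
    assume empty: "closed_nbhd E v \<inter> C = {}"
    then have "v \<notin> C" by (auto simp: closed_nbhd_def)
    have "{v, v} \<notin> E" using assms(1) by (force simp: simple_graph_def)
    moreover have "{v, u} \<notin> E" "{u, v} \<notin> E" if "u \<in> C" for u
      using that empty by (auto simp: closed_nbhd_def adjacent_def insert_commute)
    ultimately have "independent E (insert v C)"
      using C(1) by (auto simp: independent_def)
    with max[of "insert v C"] \<open>v \<notin> C\<close> show False by auto
  qed
  with C that show ?thesis by (auto simp: dominating_def)
qed

lemma maximum_matching_exists:
  fixes E :: "'v::finite set set"
  obtains M where "matching E M" "card M = matching_number E"
    "\<And>N. matching E N \<Longrightarrow> card N \<le> card M"
proof -
  let ?S = "{card M | M. matching E M}"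
  have fin: "finite ?S" by simp
  have "matching E {}" by (simp add: matching_def)
  then have "?S \<noteq> {}" by blast
  with fin have "Max ?S \<in> ?S" by (rule Max_in)
  then obtain M where M: "matching E M" "card M = Max ?S" by auto
  moreover have "card N \<le> card M" if "matching E N" for N
    unfolding M(2) using fin that by (intro Max_ge) auto
  ultimately show ?thesis using that by (simp add: matching_number_def)
qed

lemma card_matched_vertices:
  fixes E :: "'v::finite set set"
  assumes "simple_graph E" and "matching E M"
  shows "card (\<Union>M) = 2 * card M"
proof -
  have "card (\<Union>M) = sum card M"
    using assms(2) by (intro card_Union_disjoint) (auto simp: matching_def disjoint_def pairwise_def disjnt_def)
  also have "\<dots> = (\<Sum>e\<in>M. 2)"
    using assms by (intro sum.cong) (auto simp: matching_def simple_graph_def)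
  finally show ?thesis by simp
qed

lemma unmatched_vertices_independent:
  fixes E :: "'v::finite set set"
  assumes "matching E M" and max: "\<And>N. matching E N \<Longrightarrow> card N \<le> card M"
  shows "independent E (- \<Union>M)"
  unfolding independent_def
proof (intro ballI notI)
  fix u v assume uv: "u \<in> - \<Union>M" "v \<in> - \<Union>M" "{u, v} \<in> E"
  then have "matching E (insert {u, v} M)"
    using assms(1) by (auto simp: matching_def disjoint_def)
  moreover have "{u, v} \<notin> M" using uv by auto
  ultimately show False using max[of "insert {u, v} M"] by simp
qed

lemma independent_dominating_set_small_complement:
  fixes E :: "'v::finite set set"
  assumes "simple_graph E"
  obtains C where "independent E C" "dominating E C" "card (- C) \<le> 2 * matching_number E"
proof -
  obtain M where M: "matching E M" "card M = matching_number E"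
    "\<And>N. matching E N \<Longrightarrow> card N \<le> card M"
    using maximum_matching_exists[of E] by blast
  obtain C where C: "- \<Union>M \<subseteq> C" "independent E C" "dominating E C"
    by (rule independent_extends_to_dominating
          [OF assms unmatched_vertices_independent[OF M(1,3)]])
  have "card (- C) \<le> card (\<Union>M)" using C(1) by (intro card_mono) auto
  with card_matched_vertices[OF assms M(1)] M(2) C that show ?thesis by simp
qed


section \<open>Colon ideals and associated primes\<close>

text \<open>
  The colon ideal \<open>(I : f)\<close> is the annihilator of the residue class of \<open>f\<close>.
\<close>

lemma prime_colon_associated:
  assumes "ideal I R" and f: "f \<in> carrier R" and prime: "primeideal (colon_ideal R I f) R"
  shows "colon_ideal R I f \<in> associated_primes R I"
proof -
  interpret ideal I R by fact
  have "I +>\<^bsub>R\<^esub> f \<in> carrier (R Quot I)"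
    using f by (auto simp: FactRing_def A_RCOSETS_def' a_r_coset_def)
  moreover have "(I +>\<^bsub>R\<^esub> g) \<otimes>\<^bsub>R Quot I\<^esub> (I +>\<^bsub>R\<^esub> f) = \<zero>\<^bsub>R Quot I\<^esub> \<longleftrightarrow> g \<otimes>\<^bsub>R\<^esub> f \<in> I"
    if "g \<in> carrier R" for g
  proof -
    have "(I +>\<^bsub>R\<^esub> g) \<otimes>\<^bsub>R Quot I\<^esub> (I +>\<^bsub>R\<^esub> f) = I +>\<^bsub>R\<^esub> (g \<otimes>\<^bsub>R\<^esub> f)"
      using that f by (simp add: FactRing_def rcoset_mult_add)
    moreover have "\<zero>\<^bsub>R Quot I\<^esub> = I" by (simp add: FactRing_def)
    moreover have "I +>\<^bsub>R\<^esub> (g \<otimes>\<^bsub>R\<^esub> f) = I \<longleftrightarrow> g \<otimes>\<^bsub>R\<^esub> f \<in> I"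
      using that f by (metis a_rcos_const a_rcos_self m_closed)
    ultimately show ?thesis by simp
  qed
  ultimately show ?thesis
    using prime unfolding associated_primes_def colon_ideal_def by blast
qed


section \<open>Ideals generated by monomials\<close>

lemma type_algebra_simps [simp]:
  "carrier ring_of_type_algebra = UNIV"
  "x \<otimes>\<^bsub>ring_of_type_algebra\<^esub> y = x * y"
  "\<one>\<^bsub>ring_of_type_algebra\<^esub> = 1"
  "\<zero>\<^bsub>ring_of_type_algebra\<^esub> = 0"
  "x \<oplus>\<^bsub>ring_of_type_algebra\<^esub> y = x + y"
  by (simp_all add: ring_of_type_algebra_def)

lemma ideal_type_algebraI:
  fixes I :: "'a::comm_ring_1 set"
  assumes "0 \<in> I" and "\<And>x y. x \<in> I \<Longrightarrow> y \<in> I \<Longrightarrow> x + y \<in> I"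
    and mult: "\<And>x y. x \<in> I \<Longrightarrow> y * x \<in> I"
  shows "ideal I ring_of_type_algebra"
proof (rule idealI)
  interpret cring "ring_of_type_algebra :: 'a ring" by (rule cring_from_type_algebra)
  show "ring (ring_of_type_algebra :: 'a ring)" by (rule ring_from_type_algebra)
  show "subgroup I (add_monoid ring_of_type_algebra)"
  proof
    fix x assume "x \<in> I"
    have "x \<oplus>\<^bsub>ring_of_type_algebra\<^esub> - x = \<zero>\<^bsub>ring_of_type_algebra\<^esub>" by simp
    then have "\<ominus>\<^bsub>ring_of_type_algebra\<^esub> x = - x"
      by (intro minus_equality) (auto simp: add.commute)
    moreover have "- x \<in> I" using mult[OF \<open>x \<in> I\<close>, of "- 1"] by simp
    ultimately show "inv\<^bsub>add_monoid ring_of_type_algebra\<^esub> x \<in> I" by (simp add: a_inv_def)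
  qed (use assms in auto)
qed (use mult in \<open>auto simp: mult.commute\<close>)

lemma poly_mapping_sum_singles:
  "f = (\<Sum>m\<in>Poly_Mapping.keys f. Poly_Mapping.single m (Poly_Mapping.lookup f m))"
  by (rule poly_mapping_eqI)
     (auto simp: lookup_sum lookup_single when_def in_keys_iff sum.delta)

text \<open>
  Being divisible by a generator is inherited by sums and multiples, which act on the set of
  occurring monomials; conversely a polynomial is the sum of its terms, and each of
  them is a multiple of a generator.
\<close>

lemma genideal_monomials:
  fixes B :: "'a::comm_monoid_add set"
  shows "genideal ring_of_type_algebra ((\<lambda>a. Poly_Mapping.single a (1::'k::field)) ` B) =
    {f. \<forall>m\<in>Poly_Mapping.keys f. \<exists>a\<in>B. \<exists>b. m = a + b}"
    (is "?I = ?J")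
proof
  let ?R = "ring_of_type_algebra :: ('a \<Rightarrow>\<^sub>0 'k) ring"
  interpret cring ?R by (rule cring_from_type_algebra)
  have "ideal ?J ?R"
  proof (rule ideal_type_algebraI)
    fix x y :: "'a \<Rightarrow>\<^sub>0 'k"
    assume x: "x \<in> ?J"
    show "y * x \<in> ?J"
    proof safe
      fix m assume "m \<in> Poly_Mapping.keys (y * x)"
      then obtain p q where pq: "m = p + q" "q \<in> Poly_Mapping.keys x"
        using keys_mult by blast
      then obtain a b where "a \<in> B" "q = a + b" using x by blast
      with pq have "m = a + (p + b)" by (simp add: ac_simps)
      with \<open>a \<in> B\<close> show "\<exists>a\<in>B. \<exists>b. m = a + b" by blast
    qed
    assume "y \<in> ?J"
    with x keys_add[of x y] show "x + y \<in> ?J" by blast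
  qed simp
  moreover have "(\<lambda>a. Poly_Mapping.single a (1::'k)) ` B \<subseteq> ?J"
    by (fastforce intro: exI[of _ 0])
  ultimately show "?I \<subseteq> ?J" by (rule genideal_minimal)
next
  let ?R = "ring_of_type_algebra :: ('a \<Rightarrow>\<^sub>0 'k) ring"
  interpret cring ?R by (rule cring_from_type_algebra)
  interpret I: ideal ?I ?R by (rule genideal_ideal) simp
  show "?J \<subseteq> ?I"
  proof
    fix f assume f: "f \<in> ?J"
    have single_mem: "Poly_Mapping.single m c \<in> ?I" if "m \<in> Poly_Mapping.keys f" for m c
    proof -
      have "\<exists>a\<in>B. \<exists>b. m = a + b" using f that by simp
      then obtain a b where "a \<in> B" "m = a + b" by (elim bexE exE)
      then have "Poly_Mapping.single m c = Poly_Mapping.single b c * Poly_Mapping.single a 1"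
        by (simp add: mult_single add.commute)
      moreover have "Poly_Mapping.single a 1 \<in> ?I"
        using genideal_self[of "(\<lambda>a. Poly_Mapping.single a (1::'k)) ` B"] \<open>a \<in> B\<close> by auto
      ultimately show ?thesis using I.I_l_closed by simp
    qed
    have closed: "sum h K \<in> ?I" if "finite K" "\<And>m. m \<in> K \<Longrightarrow> h m \<in> ?I"
      for h :: "'a \<Rightarrow> 'a \<Rightarrow>\<^sub>0 'k" and K
      using that
    proof (induction K rule: finite_induct)
      case empty
      show ?case using I.zero_closed by simp
    next
      case (insert m K)
      then show ?case using I.a_closed[of "h m" "sum h K"] by simp
    qed
    show "f \<in> ?I"
      by (subst poly_mapping_sum_singles) (intro closed single_mem finite_keys)
  qed
qed


section \<open>Ideals generated by variables are prime\<close>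

text \<open>
  A monomial order pulled back along an arbitrary numbering of the variables: the type of
  exponent vectors on \<open>nat\<close> carries a linear order compatible with addition.
\<close>

lemma additive_embedding_into_ordered:
  obtains e :: "('v::finite \<Rightarrow>\<^sub>0 nat) \<Rightarrow> (nat \<Rightarrow>\<^sub>0 nat)"
  where "inj e" "\<And>m n. e (m + n) = e m + e n"
proof -
  obtain h :: "'v \<Rightarrow> nat" where h: "inj h"
    using finite_imp_inj_to_nat_seg[OF finite_UNIV] by blast
  define e where "e m = (\<Sum>v\<in>UNIV. Poly_Mapping.single (h v) (Poly_Mapping.lookup m v))"
    for m :: "'v \<Rightarrow>\<^sub>0 nat"
  have "Poly_Mapping.lookup (e m) (h v) = Poly_Mapping.lookup m v" for m v
    using h by (simp add: e_def lookup_sum lookup_single when_def inj_eq)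
  then have "inj e" by (intro injI poly_mapping_eqI) metis
  moreover have "e (m + n) = e m + e n" for m n
    by (simp add: e_def lookup_add single_add sum.distrib)
  ultimately show ?thesis using that by blast
qed

text \<open>
  Suppose a sum of exponents lies in \<open>N\<close> exactly if both summands do. Then the largest monomials
  of \<open>f\<close> and \<open>g\<close> among those in \<open>N\<close> cannot be cancelled in the product: the monomials outside
  \<open>N\<close> contribute nothing to a coefficient at a point of \<open>N\<close>.
\<close>

lemma keys_mult_meets:
  fixes f g :: "('v::finite \<Rightarrow>\<^sub>0 nat) \<Rightarrow>\<^sub>0 'k::field"
  assumes N: "\<And>m n. m + n \<in> N \<longleftrightarrow> m \<in> N \<and> n \<in> N"
    and f: "Poly_Mapping.keys f \<inter> N \<noteq> {}" and g: "Poly_Mapping.keys g \<inter> N \<noteq> {}"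
  shows "Poly_Mapping.keys (f * g) \<inter> N \<noteq> {}"
proof -
  obtain e :: "('v \<Rightarrow>\<^sub>0 nat) \<Rightarrow> (nat \<Rightarrow>\<^sub>0 nat)"
    where e: "inj e" "\<And>m n. e (m + n) = e m + e n"
    by (rule additive_embedding_into_ordered) blast
  have largest: "\<exists>m\<in>K. \<forall>l\<in>K. e l \<le> e m" if "finite K" "K \<noteq> {}" for K
  proof -
    have "Max (e ` K) \<in> e ` K" using that by (intro Max_in) auto
    then obtain m where "m \<in> K" "e m = Max (e ` K)" by auto
    with that(1) show ?thesis by (metis Max_ge finite_imageI imageI)
  qed
  obtain m where m: "m \<in> Poly_Mapping.keys f" "m \<in> N"
    and m_max: "\<And>l. l \<in> Poly_Mapping.keys f \<Longrightarrow> l \<in> N \<Longrightarrow> e l \<le> e m"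
    using largest[of "Poly_Mapping.keys f \<inter> N"] f by auto
  obtain n where n: "n \<in> Poly_Mapping.keys g" "n \<in> N"
    and n_max: "\<And>l. l \<in> Poly_Mapping.keys g \<Longrightarrow> l \<in> N \<Longrightarrow> e l \<le> e n"
    using largest[of "Poly_Mapping.keys g \<inter> N"] g by auto
  have unique: "l = m"
    if "l \<in> Poly_Mapping.keys f" "q \<in> Poly_Mapping.keys g" "m + n = l + q" for l q
  proof -
    have "l \<in> N" "q \<in> N" using N m(2) n(2) that(3) by metis+
    with m_max n_max that have "e l \<le> e m" "e q \<le> e n" by auto
    moreover have "e m + e n = e l + e q" using that(3) e(2) by metis
    ultimately have "e l = e m"
      by (metis add_less_le_mono order_less_irrefl order_le_less)
    with e(1) show ?thesis by (simp add: inj_eq)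
  qed
  have coeff: "Poly_Mapping.lookup f l * (\<Sum>q. Poly_Mapping.lookup g q when m + n = l + q) =
      (Poly_Mapping.lookup f m * Poly_Mapping.lookup g n when l = m)" for l
  proof (cases "l = m")
    case True
    then show ?thesis by (simp add: eq_commute)
  next
    case False
    have "Poly_Mapping.lookup f l = 0 \<or>
        (\<forall>q. (Poly_Mapping.lookup g q when m + n = l + q) = 0)"
      using unique[of l] False by (auto simp: in_keys_iff when_def)
    with False show ?thesis by auto
  qed
  have "Poly_Mapping.lookup (f * g) (m + n) = Poly_Mapping.lookup f m * Poly_Mapping.lookup g n"
    by (simp add: lookup_mult coeff)
  then have "m + n \<in> Poly_Mapping.keys (f * g)" using m n by (simp add: in_keys_iff)
  moreover have "m + n \<in> N" using N m n by blast
  ultimately show ?thesis by blast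
qed

definition variable_ideal :: "'v set \<Rightarrow> ('v, 'k::field) mpoly set" where
  "variable_ideal C =
     {f. \<forall>m\<in>Poly_Mapping.keys f. \<exists>c\<in>C. Poly_Mapping.lookup m c > 0}"

text \<open>
  Outside this ideal are the polynomials with a monomial free of the variables in \<open>C\<close>; such
  monomials satisfy the hypothesis of \<open>keys_mult_meets\<close>.
\<close>

lemma primeideal_variables:
  "primeideal (variable_ideal C :: ('v::finite, 'k::field) mpoly set) mpoly_ring"
proof (rule primeidealI)
  let ?P = "variable_ideal C :: ('v, 'k) mpoly set"
  define N where "N = {m :: 'v \<Rightarrow>\<^sub>0 nat. \<forall>c\<in>C. Poly_Mapping.lookup m c = 0}"
  have P_iff: "f \<in> ?P \<longleftrightarrow> Poly_Mapping.keys f \<inter> N = {}" for f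
    by (auto simp: variable_ideal_def N_def)
  have N: "m + n \<in> N \<longleftrightarrow> m \<in> N \<and> n \<in> N" for m n
    by (auto simp: N_def lookup_add)
  show "ideal ?P mpoly_ring"
  proof (rule ideal_type_algebraI)
    fix x y :: "('v, 'k) mpoly"
    assume x: "x \<in> ?P"
    show "y * x \<in> ?P"
      using x keys_mult[of y x] N by (fastforce simp: P_iff)
    assume "y \<in> ?P"
    with x keys_add[of x y] show "x + y \<in> ?P" by (auto simp: P_iff)
  qed (simp add: variable_ideal_def)
  have "1 \<notin> ?P" by (simp add: variable_ideal_def)
  then show "carrier mpoly_ring \<noteq> ?P" by auto
  show "a \<in> ?P \<or> b \<in> ?P" if "a \<otimes>\<^bsub>mpoly_ring\<^esub> b \<in> ?P" for a b
    using that keys_mult_meets[OF N, of a b] by (auto simp: P_iff)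
qed (rule cring_from_type_algebra)


section \<open>The closed neighborhood ideal and its colon ideal\<close>

text \<open>The exponent vector of \<open>\<Prod>u\<in>A. t\<^sub>u\<close>.\<close>

definition indicator_exponent :: "'v::finite set \<Rightarrow> 'v \<Rightarrow>\<^sub>0 nat" where
  "indicator_exponent A = (\<Sum>u\<in>A. Poly_Mapping.single u 1)"

lemma lookup_indicator_exponent:
  "Poly_Mapping.lookup (indicator_exponent A) u = of_bool (u \<in> A)"
  by (simp add: indicator_exponent_def lookup_sum lookup_single when_def)

lemma total_degree_indicator_exponent: "total_degree (indicator_exponent A) = card A"
  by (simp add: total_degree_def lookup_indicator_exponent of_bool_def sum.If_cases)

lemma prod_var_eq_single:
  "(\<Prod>u\<in>A. var u) = (Poly_Mapping.single (indicator_exponent A) 1 :: ('v::finite, 'k::field) mpoly)"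
proof (induction A rule: finite_induct[OF finite])
  case 1
  show ?case by (simp add: indicator_exponent_def)
next
  case (2 v A)
  then show ?case by (simp add: indicator_exponent_def var_def mult_single)
qed

lemma indicator_exponent_divides:
  "(\<exists>b. m = indicator_exponent A + b) \<longleftrightarrow> (\<forall>u\<in>A. Poly_Mapping.lookup m u > 0)"
proof
  assume "\<forall>u\<in>A. Poly_Mapping.lookup m u > 0"
  then have "m = indicator_exponent A + (m - indicator_exponent A)"
    by (intro poly_mapping_eqI) (auto simp: lookup_add lookup_minus lookup_indicator_exponent)
  then show "\<exists>b. m = indicator_exponent A + b" by blast
qed (auto simp: lookup_add lookup_indicator_exponent)

lemma closed_nbhd_ideal_eq_genideal:
  "closed_nbhd_ideal E = genideal mpoly_ring
     ((\<lambda>a. Poly_Mapping.single a (1::'k::field)) ` (\<lambda>v. indicator_exponent (closed_nbhd E v)) ` UNIV)"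
proof -
  have "{\<Prod>u\<in>closed_nbhd E v. var u | v. True} =
    (\<lambda>a. Poly_Mapping.single a (1::'k)) ` (\<lambda>v. indicator_exponent (closed_nbhd E v)) ` UNIV"
    by (auto simp: prod_var_eq_single)
  then show ?thesis by (simp add: closed_nbhd_ideal_def)
qed

lemma in_closed_nbhd_ideal_iff:
  "f \<in> closed_nbhd_ideal E \<longleftrightarrow>
    (\<forall>m\<in>Poly_Mapping.keys f. \<exists>v. \<forall>u\<in>closed_nbhd E v. Poly_Mapping.lookup m u > 0)"
  by (simp add: closed_nbhd_ideal_eq_genideal genideal_monomials indicator_exponent_divides)

lemma ideal_closed_nbhd_ideal:
  "ideal (closed_nbhd_ideal E :: ('v::finite, 'k::field) mpoly set) mpoly_ring"
proof -
  interpret cring "mpoly_ring :: ('v, 'k) mpoly ring" by (rule cring_from_type_algebra)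
  show ?thesis unfolding closed_nbhd_ideal_def by (rule genideal_ideal) simp
qed

lemma keys_mult_single:
  fixes g :: "'a::cancel_comm_monoid_add \<Rightarrow>\<^sub>0 'k::field"
  shows "Poly_Mapping.keys (g * Poly_Mapping.single a 1) = (\<lambda>m. m + a) ` Poly_Mapping.keys g"
proof
  show "Poly_Mapping.keys (g * Poly_Mapping.single a 1) \<subseteq> (\<lambda>m. m + a) ` Poly_Mapping.keys g"
    using keys_mult[of g "Poly_Mapping.single a 1"] by auto
  have "Poly_Mapping.lookup (g * Poly_Mapping.single a 1) (m + a) = Poly_Mapping.lookup g m" for m
  proof -
    have "Poly_Mapping.lookup g l *
        (\<Sum>q. Poly_Mapping.lookup (Poly_Mapping.single a 1) q when m + a = l + q) =
        (Poly_Mapping.lookup g m when l = m)" for l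
    proof -
      have "(Poly_Mapping.lookup (Poly_Mapping.single a (1::'k)) q when m + a = l + q) =
          ((1 when l = m) when q = a)" for q
        by (auto simp: lookup_single when_def)
      then show ?thesis by (simp add: when_def)
    qed
    then show ?thesis by (simp add: lookup_mult)
  qed
  then show "(\<lambda>m. m + a) ` Poly_Mapping.keys g \<subseteq> Poly_Mapping.keys (g * Poly_Mapping.single a 1)"
    by (auto simp: in_keys_iff)
qed

text \<open>
  A multiple of \<open>\<Prod>u\<in>-C. t\<^sub>u\<close> is divisible by the monomial of a closed neighborhood iff the cofactor
  contains the variables of its intersection with \<open>C\<close>. Domination makes this intersection nonempty;
  independence makes it \<open>{c}\<close> for the neighborhood of \<open>c \<in> C\<close>.
\<close>

lemma colon_closed_nbhd_ideal:
  assumes "independent E C" and "dominating E C"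
  shows "colon_ideal mpoly_ring (closed_nbhd_ideal E) (\<Prod>u\<in>-C. var u) =
    (variable_ideal C :: ('v::finite, 'k::field) mpoly set)"
proof -
  have monomial: "(\<exists>v. \<forall>u\<in>closed_nbhd E v. Poly_Mapping.lookup (m + indicator_exponent (-C)) u > 0)
      \<longleftrightarrow> (\<exists>c\<in>C. Poly_Mapping.lookup m c > 0)" (is "?L \<longleftrightarrow> ?R") for m
  proof
    assume ?L
    then obtain v where v: "\<And>u. u \<in> closed_nbhd E v \<Longrightarrow> u \<in> C \<Longrightarrow> Poly_Mapping.lookup m u > 0"
      by (auto simp: lookup_add lookup_indicator_exponent)
    obtain c where "c \<in> closed_nbhd E v" "c \<in> C"
      using assms(2) by (auto simp: dominating_def)
    with v show ?R by blast
  next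
    assume ?R
    then obtain c where c: "c \<in> C" "Poly_Mapping.lookup m c > 0" by blast
    have "\<forall>u\<in>closed_nbhd E c. u \<in> C \<longrightarrow> Poly_Mapping.lookup m u \<noteq> 0"
      using c assms(1) by (auto simp: closed_nbhd_def adjacent_def independent_def)
    then have "\<forall>u\<in>closed_nbhd E c. Poly_Mapping.lookup (m + indicator_exponent (-C)) u > 0"
      by (auto simp: lookup_add lookup_indicator_exponent)
    then show ?L by blast
  qed
  show ?thesis
    by (simp add: colon_ideal_def variable_ideal_def prod_var_eq_single in_closed_nbhd_ideal_iff
          keys_mult_single monomial)
qed


section \<open>The bound on the v-number\<close>

lemma v_number_le:
  assumes "f \<in> graded_component d" and "ideal I mpoly_ring"
    and "primeideal (colon_ideal mpoly_ring I f) mpoly_ring"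
  shows "v_number I \<le> d"
proof -
  have "colon_ideal mpoly_ring I f \<in> associated_primes mpoly_ring I"
    using assms(2,3) by (intro prime_colon_associated) auto
  with assms(1) show ?thesis
    unfolding v_number_def by (intro Least_le) blast
qed

theorem corollary4p2:
  fixes E :: "'v::finite set set"
  assumes "simple_graph E" and "connected_graph E"
  shows "v_number (closed_nbhd_ideal E :: ('v, 'k::field) mpoly set) \<le> 2 * matching_number E"
proof -
  obtain C where C: "independent E C" "dominating E C" "card (- C) \<le> 2 * matching_number E"
    by (rule independent_dominating_set_small_complement[OF assms(1)])
  let ?f = "\<Prod>u\<in>-C. var u :: ('v, 'k) mpoly"
  have "?f \<in> graded_component (card (- C))"
    by (simp add: prod_var_eq_single graded_component_def total_degree_indicator_exponent)
  then have "v_number (closed_nbhd_ideal E :: ('v, 'k) mpoly set) \<le> card (- C)"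
    using ideal_closed_nbhd_ideal
    by (rule v_number_le)
      (simp only: colon_closed_nbhd_ideal[OF C(1,2)] primeideal_variables)
  with C(3) show ?thesis by simp
qed

end
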